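(* Let $p^{\mathrm{CI}}\in\arg\max_{p\in\mathcal P}r(p;\theta^0)$ be the complete-information price, let $p^{\mathrm{NRM}}\in\arg\max_{p\in\mathcal P}\eta(p;\Theta)$ be the fixed price charged in every period by the non-adaptive risk-mitigating (NRM) policy, let $M=\sum_{t=1}^TN_t$ and $\bar r=\max_{p\in\mathcal P}r(p;\theta^0)$. Then the regret $R_T(\pi^{\mathrm{NRM}})$ of the NRM policy, i.e. the expected cumulative revenue of charging $p^{\mathrm{CI}}$ in every period minus that of charging $p^{\mathrm{NRM}}$ in every period, satisfies $$R_T(\pi^{\mathrm{NRM}})\ \le\ \bar r\cdot M\cdot\mathbb I\{p^{\mathrm{CI}}\ne p^{\mathrm{NRM}}\},$$ where $\mathbb I$ denotes the indicator.
   Context: A seller prices a product over $T\ge1$ periods with prices from a finite nonempty set $\mathcal P$ of reals; in period $t$, $N_t$ customers arrive ($N_t$ fixed nonnegative integers). $\Theta=\{\theta^0,\dots,\theta^m\}$ is a finite set of demand parameters with true parameter $\theta^0$; $\mu(p;\theta)$ is the mean demand and $r(p;\theta)=p\,\mu(p;\theta)$ the expected revenue. If price $p$ is offered in period $t$, each of the $N_t$ customers has demand drawn i.i.d. from a fixed distribution with mean $\mu(p;\theta^0)$. The expected cumulative revenue of a policy $\pi$ choosing (possibly random) prices $\boldsymbol p^\pi_t$ is $\mathbb E^\pi\big[\sum_{t=1}^T\boldsymbol p_t^\pi\sum_{i=1}^{N_t}\boldsymbol d_{ti}(\boldsymbol p^\pi_t)\big]$, where $\boldsymbol d_{ti}(p)$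 is the demand of customer $i$ in period $t$ at price $p$. Risk-adjusted revenue function: $\eta$ assigns to each nonempty $\mathcal A\subseteq\Theta$ a map $\eta(\cdot;\mathcal A):\mathcal P\to[0,\infty)$ such that for all $p$: (i) $\eta(p;\mathcal A)\ge\eta(p;\mathcal A')$ whenever $\mathcal A\subseteq\mathcal A'\subseteq\Theta$; (ii) $\eta(p;\{\theta^0\})=r(p;\theta^0)$ (in particular $r(p;\theta^0)\ge0$ for all $p$). *)

theory Defs
  imports "HOL-Probability.Probability"
begin

definition revenue :: "(real \<Rightarrow> 'p \<Rightarrow> real) \<Rightarrow> real \<Rightarrow> 'p \<Rightarrow> real" where
  "revenue \<mu> p \<theta> = p * \<mu> p \<theta>"

definition param_set :: "(nat \<Rightarrow> 'p) \<Rightarrow> nat \<Rightarrow> 'p set" where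
  "param_set \<theta> m = \<theta> ` {0..m}"

text \<open>
  \<open>d t i p\<close> is the demand that customer \<open>i\<close> of period \<open>t\<close> has if price \<open>p\<close> is offered
  in that period, and \<open>D p\<close> is the law of this demand. Only what the model
  says about the demands is assumed: independence of the customers of one period facing
  one price. Nothing is assumed about the joint law across periods or across prices.
\<close>

locale pricing_model = prob_space \<Omega>
  for \<Omega> :: "'w measure" +
  fixes P :: "real set"
    and T :: nat
    and N :: "nat \<Rightarrow> nat"
    and \<theta> :: "nat \<Rightarrow> 'p"
    and \<mu> :: "real \<Rightarrow> 'p \<Rightarrow> real"
    and D :: "real \<Rightarrow> real measure"
    and d :: "nat \<Rightarrow> nat \<Rightarrow> real \<Rightarrow> 'w \<Rightarrow> real"
  assumes periods: "1 \<le> T"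
    and finite_prices: "finite P"
    and prices_nonempty: "P \<noteq> {}"
    and demand_law: "p \<in> P \<Longrightarrow> prob_space (D p) \<and> sets (D p) = sets borel"
    and demand_integrable: "p \<in> P \<Longrightarrow> integrable (D p) (\<lambda>x. x)"
    and demand_mean: "p \<in> P \<Longrightarrow> (\<integral>x. x \<partial>D p) = \<mu> p (\<theta> 0)"
    and demand_indep: "\<lbrakk>t \<in> {1..T}; p \<in> P\<rbrakk> \<Longrightarrow>
          indep_vars (\<lambda>_. borel) (\<lambda>i. d t i p) {1..N t}"
    and demand_distr: "\<lbrakk>t \<in> {1..T}; i \<in> {1..N t}; p \<in> P\<rbrakk> \<Longrightarrow>
          distr \<Omega> borel (d t i p) = D p"

definition risk_adjusted_revenue ::
  "real set \<Rightarrow> (nat \<Rightarrow> 'p) \<Rightarrow> nat \<Rightarrow> (real \<Rightarrow> 'p \<Rightarrow> real) \<Rightarrow> (real \<Rightarrow> 'p set \<Rightarrow> real) \<Rightarrow> bool"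
where
  "risk_adjusted_revenue P \<theta> m \<mu> \<eta> \<longleftrightarrow>
     (\<forall>p\<in>P. \<forall>A. A \<noteq> {} \<and> A \<subseteq> param_set \<theta> m \<longrightarrow> 0 \<le> \<eta> p A) \<and>
     (\<forall>p\<in>P. \<forall>A A'. A \<noteq> {} \<and> A \<subseteq> A' \<and> A' \<subseteq> param_set \<theta> m \<longrightarrow> \<eta> p A' \<le> \<eta> p A) \<and>
     (\<forall>p\<in>P. \<eta> p {\<theta> 0} = revenue \<mu> p (\<theta> 0))"

text \<open>
  A policy enters only through the random price \<open>\<pi> t\<close> it charges in period \<open>t\<close>.
\<close>

definition expected_cumulative_revenue ::
  "'w measure \<Rightarrow> nat \<Rightarrow> (nat \<Rightarrow> nat) \<Rightarrow> (nat \<Rightarrow> nat \<Rightarrow> real \<Rightarrow> 'w \<Rightarrow> real) \<Rightarrow>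
   (nat \<Rightarrow> 'w \<Rightarrow> real) \<Rightarrow> real"
where
  "expected_cumulative_revenue \<Omega> T N d \<pi> =
     (\<integral>\<omega>. (\<Sum>t=1..T. \<pi> t \<omega> * (\<Sum>i=1..N t. d t i (\<pi> t \<omega>) \<omega>)) \<partial>\<Omega>)"

definition fixed_price_policy :: "real \<Rightarrow> nat \<Rightarrow> 'w \<Rightarrow> real" where
  "fixed_price_policy p = (\<lambda>t \<omega>. p)"

definition regret ::
  "'w measure \<Rightarrow> nat \<Rightarrow> (nat \<Rightarrow> nat) \<Rightarrow> (nat \<Rightarrow> nat \<Rightarrow> real \<Rightarrow> 'w \<Rightarrow> real) \<Rightarrow>
   real \<Rightarrow> (nat \<Rightarrow> 'w \<Rightarrow> real) \<Rightarrow> real"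
where
  "regret \<Omega> T N d pCI \<pi> =
     expected_cumulative_revenue \<Omega> T N d (fixed_price_policy pCI) -
     expected_cumulative_revenue \<Omega> T N d \<pi>"

end

theory Submission
  imports Defs
begin

text \<open>With a fixed price \<open>p\<close>, every customer contributes
  \<open>revenue \<mu> p (\<theta> 0)\<close> in expectation, so by linearity the whole horizon
  earns this amount times the total number of arrivals
  (\<open>expected_cumulative_revenue_fixed_price\<close>). The regret is therefore the per-customer
  revenue gap between \<open>pCI\<close> and \<open>pNRM\<close>, scaled by the number of arrivals.
  The gap vanishes if the prices coincide; otherwise it is at most the maximal revenue, because the
  revenue given up at \<open>pNRM\<close> is nonnegative (\<open>revenue_nonneg\<close>).\<close>

context pricing_model
begin

text \<open>Measurability of each demand is contained in the definition of
  \<open>indep_vars\<close>.\<close>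

lemma demand_random_variable:
  assumes "t \<in> {1..T}" "i \<in> {1..N t}" "p \<in> P"
  shows "random_variable borel (d t i p)"
  using demand_indep[OF assms(1,3)] assms(2) by (simp add: indep_vars_def)

lemma integrable_demand:
  assumes "t \<in> {1..T}" "i \<in> {1..N t}" "p \<in> P"
  shows "integrable \<Omega> (d t i p)"
  \<comment> \<open>Integrability of the identity under the law \<open>D p\<close> is pulled back
    along \<open>d t i p\<close>.\<close>
  using integrable_distr[OF demand_random_variable[OF assms], of "\<lambda>x. x"]
    demand_integrable[OF assms(3)] demand_distr[OF assms] by simp

lemma expectation_demand:
  assumes "t \<in> {1..T}" "i \<in> {1..N t}" "p \<in> P"
  shows "expectation (d t i p) = \<mu> p (\<theta> 0)"
  using integral_distr[OF demand_random_variable[OF assms], of "\<lambda>x. x"]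
    demand_mean[OF assms(3)] demand_distr[OF assms] by simp

lemma expected_cumulative_revenue_fixed_price:
  assumes "p \<in> P"
  shows "expected_cumulative_revenue \<Omega> T N d (fixed_price_policy p)
         = revenue \<mu> p (\<theta> 0) * real (\<Sum>t=1..T. N t)"
proof -
  have "expected_cumulative_revenue \<Omega> T N d (fixed_price_policy p)
        = (\<Sum>t=1..T. p * (\<Sum>i=1..N t. expectation (d t i p)))"
    unfolding expected_cumulative_revenue_def fixed_price_policy_def
    \<comment> \<open>Linearity is used over the periods and then over the customers of each period;
      \<open>integrable_demand\<close> discharges the side conditions.\<close>
    by (subst Bochner_Integration.integral_sum)
       (auto intro!: sum.cong Bochner_Integration.integral_sum integrable_demand assms)
  also have "\<dots> = (\<Sum>t=1..T. p * (\<Sum>i=1..N t. \<mu> p (\<theta> 0)))"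
    by (intro sum.cong refl arg_cong2[where f = "(*)"] expectation_demand assms)
  also have "\<dots> = revenue \<mu> p (\<theta> 0) * real (\<Sum>t=1..T. N t)"
    by (simp add: revenue_def sum_distrib_left mult_ac)
  finally show ?thesis .
qed

end

text \<open>The risk-adjusted revenue is nonnegative at every nonempty subset of the parameter set,
  and at the singleton of the true parameter it equals the expected revenue.\<close>

lemma revenue_nonneg:
  assumes "risk_adjusted_revenue P \<theta> m \<mu> \<eta>" "p \<in> P"
  shows "0 \<le> revenue \<mu> p (\<theta> 0)"
proof -
  have "{\<theta> 0} \<subseteq> param_set \<theta> m"
    by (simp add: param_set_def)
  then have "0 \<le> \<eta> p {\<theta> 0}"
    using assms unfolding risk_adjusted_revenue_def by blast
  then show ?thesis
    using assms by (simp add: risk_adjusted_revenue_def)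
qed

theorem mainTheorem9:
  fixes \<Omega> :: "'w measure"
    and P :: "real set"
    and T m :: nat
    and N :: "nat \<Rightarrow> nat"
    and \<theta> :: "nat \<Rightarrow> 'p"
    and \<mu> :: "real \<Rightarrow> 'p \<Rightarrow> real"
    and D :: "real \<Rightarrow> real measure"
    and d :: "nat \<Rightarrow> nat \<Rightarrow> real \<Rightarrow> 'w \<Rightarrow> real"
    and \<eta> :: "real \<Rightarrow> 'p set \<Rightarrow> real"
    and pCI pNRM :: real
  assumes "pricing_model \<Omega> P T N \<theta> \<mu> D d"
    and "risk_adjusted_revenue P \<theta> m \<mu> \<eta>"
    and "is_arg_max (\<lambda>p. revenue \<mu> p (\<theta> 0)) (\<lambda>p. p \<in> P) pCI"
    and "is_arg_max (\<lambda>p. \<eta> p (param_set \<theta> m)) (\<lambda>p. p \<in> P) pNRM"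
  shows "regret \<Omega> T N d pCI (fixed_price_policy pNRM)
         \<le> (MAX p\<in>P. revenue \<mu> p (\<theta> 0)) * real (\<Sum>t=1..T. N t) * of_bool (pCI \<noteq> pNRM)"
proof -
  interpret pricing_model \<Omega> P T N \<theta> \<mu> D d
    by (fact assms(1))
  have "pCI \<in> P" "pNRM \<in> P"
    using assms(3,4) by (simp_all add: is_arg_max_def)
  note fixed_price = this[THEN expected_cumulative_revenue_fixed_price]
  have "revenue \<mu> pCI (\<theta> 0) \<le> (MAX p\<in>P. revenue \<mu> p (\<theta> 0))"
    using \<open>pCI \<in> P\<close> finite_prices by (intro Max_ge) auto
  moreover have "0 \<le> revenue \<mu> pNRM (\<theta> 0)"
    using assms(2) \<open>pNRM \<in> P\<close> by (rule revenue_nonneg)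
  \<comment> \<open>For equal prices both sides are 0; for distinct prices the subtracted
    nonnegative revenue is dropped and the first one bounded by the maximum.\<close>
  ultimately have "revenue \<mu> pCI (\<theta> 0) - revenue \<mu> pNRM (\<theta> 0)
      \<le> (MAX p\<in>P. revenue \<mu> p (\<theta> 0)) * of_bool (pCI \<noteq> pNRM)"
    by simp
  then have "(revenue \<mu> pCI (\<theta> 0) - revenue \<mu> pNRM (\<theta> 0)) * real (\<Sum>t=1..T. N t)
      \<le> (MAX p\<in>P. revenue \<mu> p (\<theta> 0)) * of_bool (pCI \<noteq> pNRM) * real (\<Sum>t=1..T. N t)"
    by (rule mult_right_mono) (rule of_nat_0_le_iff)
  then show ?thesis
    unfolding regret_def fixed_price by (simp only: left_diff_distrib right_diff_distrib mult_ac)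
qed

end
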